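(* Let $n=2$ and let $\lambda>0$ be arbitrary. Then for every $f\in C^{0,1}_c(\overline\Sigma)$ with $f(0)\ne0$ one has $$\underline{\partial_s}\mathcal A[f](0^+)<0.$$ In particular, $\Sigma$ is unstable in $\Omega_\lambda$, i.e. the stability condition "$\underline{\partial_s}\mathcal A[f](0^+)\ge0$ for all $f\in C^{0,1}_c(\overline\Sigma)$" fails.
   Context: Let $n\ge2$ be an integer and $\lambda>0$. Write points of $\mathbb R^{n+1}$ as $(x',x_n,x_{n+1})$ with $x'\in\mathbb R^{n-1}$. Let $\omega_\lambda(x',x_{n+1})=\lambda\sqrt{|x'|^2+x_{n+1}^2}$, let $$\Omega_\lambda=\{(x',x_n,x_{n+1})\in\mathbb R^{n+1}: x_n>\omega_\lambda(x',x_{n+1})\}$$ (a convex circular cone), and let $\Sigma=\Omega_\lambda\cap\{x_{n+1}=0\}$. A point $x=(x',x_n)\in\mathbb R^n$ is identified with $(x,0)\in\mathbb R^{n+1}$, so that $\Sigma=\{(x',x_n)\in\mathbb R^n: x_n>\lambda|x'|\}$ and $\overline\Sigma=\{x_n\ge\lambda|x'|\}$. $C^{0,1}_c(\overline\Sigma)$ is the set of Lipschitz functions $f:\overline\Sigma\to\mathbb R$ whose support $\operatorname{spt}(f)$ is a compact subset of $\overline\Sigma$ (so $f$ need not vanish on $\partial\Sigma$). For $f\in C^{0,1}_c(\overline\Sigma)$, $x\in\overline\Sigma$, $t\in\mathbb R$, define the flow $$\Phi[f](x,t)=\Big(x',\ x_n+\lambda\sqrt{|x'|^2+t^2f(x)^2}-\lambda|x'|,\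 t f(x)\Big)\in\mathbb R^{n+1},$$ the area $A[f](t)=\mathcal H^n\big(\Phi[f](\Sigma\cap\operatorname{spt}(f),t)\big)$ (with $\mathcal H^n$ the $n$-dimensional Hausdorff measure), and, for $s\ge0$, $\mathcal A[f](s)=A[f](\sqrt s)$. The lower right derivative at $0$ is $$\underline{\partial_s}\mathcal A[f](0^+)=\liminf_{s\to0^+}\frac{\mathcal A[f](s)-\mathcal A[f](0)}{s}\in[-\infty,+\infty]$$ (the value $-\infty$ is allowed and counts as $<0$). *)

theory Defs
  imports "HOL-Analysis.Analysis"
begin

text \<open>
  Hausdorff measure of integer dimension \<open>k\<close>, normalised so that it agrees with Lebesgue measure
  on \<open>k\<close>-dimensional Euclidean space. Covering sets are required to be bounded because
  \<^const>\<open>diameter\<close> is unspecified on unbounded sets; the empty set is given gauge \<open>0\<close> so that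
  finite covers count also when \<open>k = 0\<close>.
\<close>

definition hausdorff_gauge :: "nat \<Rightarrow> 'a::metric_space set \<Rightarrow> ennreal" where
  "hausdorff_gauge k U =
     (if U = {} then 0 else ennreal (unit_ball_vol (real k) * (diameter U / 2) ^ k))"

definition hausdorff_premeasure :: "nat \<Rightarrow> real \<Rightarrow> 'a::metric_space set \<Rightarrow> ennreal" where
  "hausdorff_premeasure k \<delta> A =
     (INF U \<in> {U :: nat \<Rightarrow> 'a set. A \<subseteq> (\<Union>i. U i) \<and> (\<forall>i. bounded (U i) \<and> diameter (U i) \<le> \<delta>)}.
        \<Sum>i. hausdorff_gauge k (U i))"

definition hausdorff_measure :: "nat \<Rightarrow> 'a::metric_space set \<Rightarrow> ennreal" where
  "hausdorff_measure k A = (SUP \<delta> \<in> {0<..}. hausdorff_premeasure k \<delta> A)"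

text \<open>
  The type \<open>'a\<close> plays the role of \<open>\<real>\<^sup>n\<^sup>-\<^sup>1\<close>, so \<open>\<real>\<^sup>n\<close> is \<open>'a \<times> real\<close> with points \<open>(x', x\<^sub>n)\<close> and
  \<open>\<real>\<^sup>n\<^sup>+\<^sup>1\<close> is \<open>'a \<times> real \<times> real\<close> with points \<open>(x', x\<^sub>n, x\<^sub>n\<^sub>+\<^sub>1)\<close>; the product norms are Euclidean.
\<close>

definition cone_profile :: "real \<Rightarrow> 'a::euclidean_space \<Rightarrow> real \<Rightarrow> real" where
  "cone_profile lam x' z = lam * sqrt ((norm x')\<^sup>2 + z\<^sup>2)"

definition circular_cone :: "real \<Rightarrow> ('a::euclidean_space \<times> real \<times> real) set" where
  "circular_cone lam = {(x', y, z). y > cone_profile lam x' z}"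

definition cone_section :: "real \<Rightarrow> ('a::euclidean_space \<times> real) set" where
  "cone_section lam = {(x', y). (x', y, 0) \<in> circular_cone lam}"

text \<open>
  Functions on a closed set \<open>S\<close> are represented by total functions whose values off \<open>S\<close> are ignored.
\<close>

definition spt_on :: "'a::topological_space set \<Rightarrow> ('a \<Rightarrow> real) \<Rightarrow> 'a set" where
  "spt_on S f = closure {x \<in> S. f x \<noteq> 0}"

definition lipschitz_compact_support :: "'a::metric_space set \<Rightarrow> ('a \<Rightarrow> real) set" where
  "lipschitz_compact_support S = {f. (\<exists>L. L-lipschitz_on S f) \<and> compact (spt_on S f)}"

definition cone_flow ::
    "real \<Rightarrow> ('a::euclidean_space \<times> real \<Rightarrow> real) \<Rightarrow> 'a \<times> real \<Rightarrow> real \<Rightarrow> 'a \<times> real \<times> real" where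
  "cone_flow lam f x t =
     (fst x,
      snd x + lam * sqrt ((norm (fst x))\<^sup>2 + t\<^sup>2 * (f x)\<^sup>2) - lam * norm (fst x),
      t * f x)"

definition flow_area :: "real \<Rightarrow> ('a::euclidean_space \<times> real \<Rightarrow> real) \<Rightarrow> real \<Rightarrow> ereal" where
  "flow_area lam f t =
     enn2ereal (hausdorff_measure DIM('a \<times> real)
       ((\<lambda>x. cone_flow lam f x t) ` (cone_section lam \<inter> spt_on (closure (cone_section lam)) f)))"

definition flow_area_sqrt :: "real \<Rightarrow> ('a::euclidean_space \<times> real \<Rightarrow> real) \<Rightarrow> real \<Rightarrow> ereal" where
  "flow_area_sqrt lam f s = flow_area lam f (sqrt s)"

definition lower_right_derivative_0 :: "(real \<Rightarrow> ereal) \<Rightarrow> ereal" where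
  "lower_right_derivative_0 g = Liminf (at_right 0) (\<lambda>s. (g s - g 0) / ereal s)"

text \<open>Nonnegativity of the lower right derivative for all admissible \<open>f\<close>, in dimension \<open>n = DIM('a) + 1\<close>.\<close>

definition stable_cone_section :: "'a::euclidean_space itself \<Rightarrow> real \<Rightarrow> bool" where
  "stable_cone_section _ lam \<longleftrightarrow>
     (\<forall>f \<in> lipschitz_compact_support (closure (cone_section lam :: ('a \<times> real) set)).
        lower_right_derivative_0 (flow_area_sqrt lam f) \<ge> 0)"

end

theory Submission
  imports Defs
begin

text \<open>
  Projecting the flow to its first two coordinates gives a planar map
  \<open>P(x, y) = (x, y + \<lambda> (sqrt (x\<^sup>2 + t\<^sup>2 f\<^sup>2) - \<bar>x\<bar>))\<close>, and the flowed surface is the graph over the image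
  of \<open>P\<close> of a function with Lipschitz constant \<open>O(t)\<close>; so its area is at most \<open>1 + O(t\<^sup>2)\<close> times that of the image.
  On each vertical ray \<open>P\<close> is increasing and fixes the zeros of \<open>f\<close>, so \<open>P\<close> maps
  \<open>E = \<Sigma> \<inter> spt f\<close> into the part of \<open>E\<close> above the moved boundary
  \<open>y = \<lambda> sqrt (x\<^sup>2 + t\<^sup>2 f(x, \<lambda>\<bar>x\<bar>)\<^sup>2)\<close>. If \<open>f(0) \<noteq> 0\<close>, the strip lost below that boundary has
  height of order \<open>t\<^sup>2 / \<bar>x\<bar>\<close> for \<open>\<bar>x\<bar>\<close> between \<open>O(t)\<close> and a constant, hence area at least a constant times
  \<open>t\<^sup>2 ln (1/t)\<close>, which beats the \<open>O(t\<^sup>2)\<close> gain. Neither an area formula nor the exact identity of Hausdorff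
  and Lebesgue measure is needed: the cruder bound \<open>Lebesgue \<le> 2\<^sup>n Hausdorff\<close> suffices for the strip.
\<close>

subsection \<open>Hausdorff measure\<close>

text \<open>Lower bounds for a premeasure, an infimum over covers, are proved with the constant
  divided out on the left; this moves it back.\<close>

lemma ennreal_le_mult_of_divide_le:
  assumes "x / ennreal c \<le> y" "0 < c"
  shows "x \<le> ennreal c * y"
proof -
  have "x = x / ennreal c * ennreal c"
    using assms by (simp add: ennreal_divide_times ennreal_mult_divide_eq flip: ennreal_times_divide)
  also have "\<dots> \<le> y * ennreal c" using assms by (intro mult_right_mono) auto
  finally show ?thesis by (simp add: mult.commute)
qed

lemma diameter_leI:
  fixes S :: "'a::metric_space set"
  assumes "0 \<le> d" "\<And>x y. x \<in> S \<Longrightarrow> y \<in> S \<Longrightarrow> dist x y \<le> d"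
  shows "diameter S \<le> d"
proof (cases "S = {}")
  case False
  then show ?thesis
    unfolding diameter_def using assms(2) by (auto intro!: cSUP_least)
qed (use assms in \<open>simp add: diameter_def\<close>)

text \<open>The gauge is homogeneous of degree \<open>k\<close> in the diameter. The condition on
  \<open>V\<close> is tied to \<open>U \<noteq> {}\<close> because the empty set has gauge 0 by
  convention.\<close>

lemma hausdorff_gauge_le:
  assumes "U \<noteq> {} \<Longrightarrow> V \<noteq> {} \<and> 0 \<le> diameter U \<and> diameter U \<le> c * diameter V"
    and "0 \<le> c"
  shows "hausdorff_gauge k U \<le> ennreal (c ^ k) * hausdorff_gauge k V"
proof (cases "U = {}")
  case False
  have "(diameter U / 2) ^ k \<le> (c * diameter V / 2) ^ k"
    using assms(1)[OF False] by (intro power_mono) auto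
  also have "\<dots> = c ^ k * (diameter V / 2) ^ k"
    by (simp add: power_mult_distrib flip: times_divide_eq_right)
  finally have "unit_ball_vol (real k) * (diameter U / 2) ^ k
      \<le> c ^ k * (unit_ball_vol (real k) * (diameter V / 2) ^ k)"
    by (metis mult.left_commute mult_left_mono of_nat_0_le_iff unit_ball_vol_nonneg)
  then show ?thesis
    using False assms
    by (auto simp: hausdorff_gauge_def simp flip: ennreal_mult' intro!: ennreal_leI)
qed (simp add: hausdorff_gauge_def)

lemma hausdorff_gauge_mono:
  assumes "U \<subseteq> V" "bounded V"
  shows "hausdorff_gauge k U \<le> hausdorff_gauge k V"
  using hausdorff_gauge_le[of U V 1 k] assms
  by (auto intro: diameter_subset diameter_ge_0 bounded_subset)

lemma hausdorff_premeasure_le: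
  assumes "A \<subseteq> (\<Union>i. U i)" "\<And>i. bounded (U i)" "\<And>i. diameter (U i) \<le> \<delta>"
  shows "hausdorff_premeasure k \<delta> A \<le> (\<Sum>i. hausdorff_gauge k (U i))"
  unfolding hausdorff_premeasure_def using assms by (intro INF_lower) auto

lemma hausdorff_premeasure_greatest:
  assumes "\<And>U. A \<subseteq> (\<Union>i. U i) \<Longrightarrow> (\<And>i. bounded (U i)) \<Longrightarrow> (\<And>i. diameter (U i) \<le> \<delta>) \<Longrightarrow>
             z \<le> (\<Sum>i. hausdorff_gauge k (U i))"
  shows "z \<le> hausdorff_premeasure k \<delta> A"
  unfolding hausdorff_premeasure_def using assms by (intro INF_greatest) auto

lemma hausdorff_premeasure_mono:
  fixes A :: "'a::metric_space set"
  assumes "A \<subseteq> B" "\<delta>' \<le> \<delta>"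
  shows "hausdorff_premeasure k \<delta> A \<le> hausdorff_premeasure k \<delta>' B"
proof (rule hausdorff_premeasure_greatest, rule hausdorff_premeasure_le)
  fix U :: "nat \<Rightarrow> 'a set"
  assume U: "B \<subseteq> (\<Union>i. U i)" "\<And>i. bounded (U i)" "\<And>i. diameter (U i) \<le> \<delta>'"
  show "A \<subseteq> (\<Union>i. U i)" using U assms by auto
  show "bounded (U i)" for i by (rule U)
  show "diameter (U i) \<le> \<delta>" for i using U(3)[of i] assms by linarith
qed

lemma hausdorff_premeasure_le_measure:
  "0 < \<delta> \<Longrightarrow> hausdorff_premeasure k \<delta> A \<le> hausdorff_measure k A"
  unfolding hausdorff_measure_def by (rule SUP_upper) simp

lemma hausdorff_measure_mono:
  assumes "A \<subseteq> B"
  shows "hausdorff_measure k A \<le> hausdorff_measure k B"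
  unfolding hausdorff_measure_def
  using assms by (intro SUP_mono) (auto intro!: bexI hausdorff_premeasure_mono)

section \<open>Lipschitz comparison of images and separated unions\<close>

lemma hausdorff_measure_image_le:
  fixes F :: "'a \<Rightarrow> 'b::metric_space" and P :: "'a \<Rightarrow> 'c::metric_space"
  assumes "0 < c" and F: "\<And>x y. x \<in> A \<Longrightarrow> y \<in> A \<Longrightarrow> dist (F x) (F y) \<le> c * dist (P x) (P y)"
  shows "hausdorff_measure k (F ` A) \<le> ennreal (c ^ k) * hausdorff_measure k (P ` A)"
  unfolding hausdorff_measure_def[of _ "F ` A"]
proof (rule SUP_least)
  fix \<delta> :: real assume "\<delta> \<in> {0<..}"
  then have \<delta>: "0 < \<delta>" by simp
  have ck: "0 < c ^ k" using assms by simp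
  have "hausdorff_premeasure k \<delta> (F ` A) / ennreal (c ^ k)
      \<le> hausdorff_premeasure k (\<delta> / c) (P ` A)"
  proof (rule hausdorff_premeasure_greatest)
    fix U :: "nat \<Rightarrow> 'c set"
    assume U: "P ` A \<subseteq> (\<Union>i. U i)" "\<And>i. bounded (U i)" "\<And>i. diameter (U i) \<le> \<delta> / c"
    define V where "V i = F ` {x \<in> A. P x \<in> U i}" for i :: nat
    have dV: "dist v w \<le> c * diameter (U i)" if vw: "v \<in> V i" "w \<in> V i" for v w i
    proof -
      obtain x y where xy: "x \<in> A" "P x \<in> U i" "v = F x" "y \<in> A" "P y \<in> U i" "w = F y"
        using vw by (auto simp: V_def)
      have "dist v w \<le> c * dist (P x) (P y)" using F xy by simp
      also have "\<dots> \<le> c * diameter (U i)"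
        using xy U(2) \<open>0 < c\<close> by (intro mult_left_mono diameter_bounded_bound) auto
      finally show ?thesis .
    qed
    have bV: "bounded (V i)" for i
      unfolding bounded_two_points using dV by blast
    have cd: "0 \<le> c * diameter (U i)" for i
      using U(2) \<open>0 < c\<close> by (simp add: diameter_ge_0)
    have diamV: "diameter (V i) \<le> c * diameter (U i)" for i
      using dV cd by (intro diameter_leI) auto
    have "hausdorff_premeasure k \<delta> (F ` A) \<le> (\<Sum>i. hausdorff_gauge k (V i))"
    proof (rule hausdorff_premeasure_le)
      show "F ` A \<subseteq> (\<Union>i. V i)" using U(1) unfolding V_def by blast
      show "bounded (V i)" for i by (rule bV)
      have "c * diameter (U i) \<le> \<delta>" for i
        using U(3)[of i] \<open>0 < c\<close> by (simp add: field_simps)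
      then show "diameter (V i) \<le> \<delta>" for i using diamV[of i] by (meson order_trans)
    qed
    also have "\<dots> \<le> (\<Sum>i. ennreal (c ^ k) * hausdorff_gauge k (U i))"
      using bV diamV \<open>0 < c\<close>
      by (intro suminf_le hausdorff_gauge_le) (auto simp: V_def diameter_ge_0)
    finally have "hausdorff_premeasure k \<delta> (F ` A) \<le> ennreal (c ^ k) * (\<Sum>i. hausdorff_gauge k (U i))"
      by simp
    then show "hausdorff_premeasure k \<delta> (F ` A) / ennreal (c ^ k) \<le> (\<Sum>i. hausdorff_gauge k (U i))"
      using ck by (simp add: divide_le_posI_ennreal ennreal_zero_less_divide)
  qed
  also have "\<dots> \<le> hausdorff_measure k (P ` A)"
    using \<delta> \<open>0 < c\<close> by (intro hausdorff_premeasure_le_measure) simp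
  finally have "hausdorff_premeasure k \<delta> (F ` A) / ennreal (c ^ k) \<le> hausdorff_measure k (P ` A)" .
  then show "hausdorff_premeasure k \<delta> (F ` A) \<le> ennreal (c ^ k) * hausdorff_measure k (P ` A)"
    using ck by (rule ennreal_le_mult_of_divide_le)
qed

text \<open>The metric outer measure property: a covering set of diameter below \<open>d\<close>
  cannot meet both \<open>A\<close> and \<open>B\<close>, so a fine cover of the union splits into
  covers of the two sets.\<close>

lemma hausdorff_measure_add_le:
  fixes A :: "'a::metric_space set"
  assumes "0 < d" and sep: "\<And>a b. a \<in> A \<Longrightarrow> b \<in> B \<Longrightarrow> d \<le> dist a b"
  shows "hausdorff_measure k A + hausdorff_measure k B \<le> hausdorff_measure k (A \<union> B)"
proof -
  have *: "hausdorff_premeasure k \<delta> A + hausdorff_premeasure k \<delta> B \<le> hausdorff_premeasure k \<delta> (A \<union> B)"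
    if "\<delta> < d" for \<delta>
  proof (rule hausdorff_premeasure_greatest)
    fix U :: "nat \<Rightarrow> 'a set"
    assume U: "A \<union> B \<subseteq> (\<Union>i. U i)" "\<And>i. bounded (U i)" "\<And>i. diameter (U i) \<le> \<delta>"
    have bd: "bounded (U i \<inter> S)" for i S using U(2) by (auto intro: bounded_subset)
    have dm: "diameter (U i \<inter> S) \<le> \<delta>" for i S
      using diameter_subset[of "U i \<inter> S" "U i"] U(2,3)[of i] by auto
    have "hausdorff_premeasure k \<delta> A + hausdorff_premeasure k \<delta> B
        \<le> (\<Sum>i. hausdorff_gauge k (U i \<inter> A)) + (\<Sum>i. hausdorff_gauge k (U i \<inter> B))"
      using U(1) bd dm by (intro add_mono hausdorff_premeasure_le) auto
    also have "\<dots> = (\<Sum>i. hausdorff_gauge k (U i \<inter> A) + hausdorff_gauge k (U i \<inter> B))"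
      by (rule suminf_add) auto
    also have "\<dots> \<le> (\<Sum>i. hausdorff_gauge k (U i))"
    proof (rule suminf_le)
      fix i
      have "U i \<inter> A = {} \<or> U i \<inter> B = {}"
        using diameter_bounded_bound[OF U(2)] U(3)[of i] sep that by fastforce
      then show "hausdorff_gauge k (U i \<inter> A) + hausdorff_gauge k (U i \<inter> B) \<le> hausdorff_gauge k (U i)"
        using hausdorff_gauge_mono[of "U i \<inter> A" "U i" k] hausdorff_gauge_mono[of "U i \<inter> B" "U i" k] U(2)
        by (auto simp: hausdorff_gauge_def[of _ "{}"])
    qed auto
    finally show "hausdorff_premeasure k \<delta> A + hausdorff_premeasure k \<delta> B \<le> (\<Sum>i. hausdorff_gauge k (U i))" .
  qed
  have "hausdorff_measure k A + hausdorff_measure k B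
      = (SUP \<delta>\<in>{0<..}. hausdorff_premeasure k \<delta> A + hausdorff_premeasure k \<delta> B)"
    unfolding hausdorff_measure_def
  \<comment> \<open>Premeasures grow as the mesh shrinks, so the two suprema can be taken along a
    common mesh.\<close>
  proof (rule SUP_add_directed_ennreal[symmetric])
    fix i j :: real assume "i \<in> {0<..}" "j \<in> {0<..}"
    then show "\<exists>l\<in>{0<..}. hausdorff_premeasure k i A + hausdorff_premeasure k j B
        \<le> hausdorff_premeasure k l A + hausdorff_premeasure k l B"
      by (intro bexI[of _ "min i j"] add_mono hausdorff_premeasure_mono) auto
  qed
  also have "\<dots> \<le> hausdorff_measure k (A \<union> B)"
  proof (rule SUP_least)
    fix \<delta> :: real assume "\<delta> \<in> {0<..}"
    define \<delta>' where "\<delta>' = min \<delta> (d / 2)"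
    have d': "0 < \<delta>'" "\<delta>' < d" "\<delta>' \<le> \<delta>"
      using \<open>\<delta> \<in> {0<..}\<close> \<open>0 < d\<close> by (auto simp: \<delta>'_def)
    have "hausdorff_premeasure k \<delta> A + hausdorff_premeasure k \<delta> B
        \<le> hausdorff_premeasure k \<delta>' A + hausdorff_premeasure k \<delta>' B"
      using d' by (intro add_mono hausdorff_premeasure_mono) auto
    also have "\<dots> \<le> hausdorff_premeasure k \<delta>' (A \<union> B)" by (rule *) fact
    also have "\<dots> \<le> hausdorff_measure k (A \<union> B)"
      by (rule hausdorff_premeasure_le_measure) fact
    finally show "hausdorff_premeasure k \<delta> A + hausdorff_premeasure k \<delta> B
        \<le> hausdorff_measure k (A \<union> B)" .
  qed
  finally show ?thesis .
qed

section \<open>Comparison with Lebesgue measure and finiteness on bounded planar sets\<close>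

text \<open>A set of diameter \<open>d\<close> lies in a ball of radius \<open>d\<close> about any
  of its points, while its gauge is the volume of a ball of radius \<open>d / 2\<close>. Hence the
  factor \<open>2 ^ DIM('a)\<close>.\<close>

lemma emeasure_lborel_le_hausdorff_measure:
  fixes A :: "'a::euclidean_space set"
  shows "emeasure lborel A \<le> ennreal (2 ^ DIM('a)) * hausdorff_measure DIM('a) A"
proof -
  have "emeasure lborel A / ennreal (2 ^ DIM('a)) \<le> hausdorff_premeasure DIM('a) 1 A"
  proof (rule hausdorff_premeasure_greatest)
    fix U :: "nat \<Rightarrow> 'a set"
    assume U: "A \<subseteq> (\<Union>i. U i)" "\<And>i. bounded (U i)" "\<And>i. diameter (U i) \<le> 1"
    define V where "V i = (if U i = {} then {} else cball (SOME x. x \<in> U i) (diameter (U i)))" for i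
    have UV: "U i \<subseteq> V i" for i
      unfolding V_def using diameter_bounded_bound[OF U(2)] some_in_eq[of "U i"] by auto
    have eV: "emeasure lborel (V i) \<le> ennreal (2 ^ DIM('a)) * hausdorff_gauge DIM('a) (U i)" for i
      using U(2)[of i]
      by (auto simp: V_def hausdorff_gauge_def emeasure_cball diameter_ge_0 power_divide
          simp flip: ennreal_mult')
    have "emeasure lborel A \<le> emeasure lborel (\<Union>i. V i)"
    proof (rule emeasure_mono)
      show "A \<subseteq> (\<Union>i. V i)" using U(1) UV by blast
    qed (auto simp: V_def)
    also have "\<dots> \<le> (\<Sum>i. emeasure lborel (V i))"
      by (intro emeasure_subadditive_countably) (auto simp: V_def)
    also have "\<dots> \<le> (\<Sum>i. ennreal (2 ^ DIM('a)) * hausdorff_gauge DIM('a) (U i))"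
      by (intro suminf_le eV) auto
    finally have "emeasure lborel A \<le> ennreal (2 ^ DIM('a)) * (\<Sum>i. hausdorff_gauge DIM('a) (U i))"
      by simp
    then show "emeasure lborel A / ennreal (2 ^ DIM('a)) \<le> (\<Sum>i. hausdorff_gauge DIM('a) (U i))"
      by (simp add: divide_le_posI_ennreal ennreal_zero_less_divide)
  qed
  also have "\<dots> \<le> hausdorff_measure DIM('a) A"
    by (rule hausdorff_premeasure_le_measure) simp
  finally show ?thesis by (rule ennreal_le_mult_of_divide_le) simp
qed

lemma square_covered_by_grid:
  fixes R :: real
  assumes "0 < N" "x \<in> {0..R}"
  shows "\<exists>i<N. real i * R / N \<le> x \<and> x \<le> real (Suc i) * R / N"
proof (cases "x = R")
  case True
  then show ?thesis using assms
    \<comment> \<open>The right endpoint belongs to the last closed cell; the floor used below would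
      give the index \<open>N\<close>.\<close>
    by (intro exI[of _ "N - 1"]) (auto simp: field_simps of_nat_diff mult_right_mono)
next
  case False
  then have R: "0 < R" "x < R" "0 \<le> x" using assms by auto
  define i where "i = nat \<lfloor>x * N / R\<rfloor>"
  have 1: "real i \<le> x * N / R" "x * N / R < real i + 1"
    using R by (auto simp: i_def)
  have "x * N / R < N" using R assms by (simp add: field_simps)
  with 1 have "i < N" by linarith
  then show ?thesis using 1 R assms
    by (intro exI[of _ i]) (auto simp: field_simps)
qed

text \<open>A square of side \<open>R\<close> is cut into \<open>N * N\<close> cells of side
  \<open>h = R / N\<close>. Each gauge is at most a constant times \<open>h\<^sup>2\<close>, so the
  total does not depend on the mesh.\<close>

lemma hausdorff_measure_2_bounded:
  fixes A :: "(real \<times> real) set"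
  assumes "bounded A"
  shows "hausdorff_measure 2 A < top"
proof -
  obtain B where B: "\<And>p. p \<in> A \<Longrightarrow> norm p \<le> B" "0 < B"
    using assms bounded_pos by metis
  define R where "R = 2 * B"
  have R: "0 < R" using B by (simp add: R_def)
  have coord: "\<bar>fst p\<bar> \<le> B" "\<bar>snd p\<bar> \<le> B" if "p \<in> A" for p
    using B(1)[OF that] norm_fst_le[of "fst p" "snd p"] norm_snd_le[of "snd p" "fst p"]
    by auto
  have "hausdorff_measure 2 A \<le> ennreal (unit_ball_vol 2 * R\<^sup>2)"
    unfolding hausdorff_measure_def
  proof (rule SUP_least)
    fix \<delta> :: real assume "\<delta> \<in> {0<..}"
    then have \<delta>: "0 < \<delta>" by simp
    obtain N :: nat where N: "2 * R / \<delta> < N" using reals_Archimedean2 by blast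
    have N0: "0 < N" using N R \<delta> by (cases N) (auto simp: field_simps)
    define h where "h = R / N"
    have h: "0 < h" "2 * h \<le> \<delta>" "N * h = R"
      using N N0 R \<delta> by (auto simp: h_def field_simps)
    define Q where "Q i = {real i * h - B .. real (Suc i) * h - B}" for i
    \<comment> \<open>The cells are numbered row by row and the sequence is filled up with empty
      sets, which have gauge 0.\<close>
    define U where "U n = (if n < N * N then Q (n div N) \<times> Q (n mod N) else {})" for n
    have cov: "\<exists>i<N. x \<in> Q i" if "\<bar>x\<bar> \<le> B" for x
    proof -
      have "x + B \<in> {0..R}" using that by (auto simp: R_def)
      from square_covered_by_grid[OF N0 this] show ?thesis
        by (auto simp: Q_def h_def algebra_simps)
    qed
    have bU: "bounded (U n)" for n by (auto simp: U_def Q_def intro!: bounded_Times)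
    have dU: "diameter (U n) \<le> 2 * h" for n
    proof (rule diameter_leI)
      fix p q assume pq: "p \<in> U n" "q \<in> U n"
      then have "\<bar>fst p - fst q\<bar> \<le> h" "\<bar>snd p - snd q\<bar> \<le> h"
        by (auto simp: U_def Q_def algebra_simps split: if_splits)
      moreover have "dist p q \<le> \<bar>fst p - fst q\<bar> + \<bar>snd p - snd q\<bar>"
        using sqrt_sum_squares_le_sum_abs by (simp add: dist_prod_def dist_real_def)
      ultimately show "dist p q \<le> 2 * h" by linarith
    qed (use h in simp)
    have "hausdorff_premeasure 2 \<delta> A \<le> (\<Sum>n. hausdorff_gauge 2 (U n))"
    proof (rule hausdorff_premeasure_le)
      show "A \<subseteq> (\<Union>n. U n)"
      proof
        fix p assume p: "p \<in> A"
        obtain i j where ij: "i < N" "j < N" "fst p \<in> Q i" "snd p \<in> Q j"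
          using cov coord[OF p] by blast
        have "i * N + j < Suc i * N" using ij by simp
        also have "\<dots> \<le> N * N" using ij by (intro mult_right_mono) auto
        finally have "p \<in> U (i * N + j)"
          using ij N0 by (cases p) (auto simp: U_def)
        then show "p \<in> (\<Union>n. U n)" by blast
      qed
      show "diameter (U n) \<le> \<delta>" for n using dU[of n] h by linarith
    qed (rule bU)
    also have "\<dots> = (\<Sum>n<N*N. hausdorff_gauge 2 (U n))"
      by (rule suminf_finite) (auto simp: U_def hausdorff_gauge_def)
    also have "\<dots> \<le> (\<Sum>n<N*N. ennreal (unit_ball_vol 2 * h\<^sup>2))"
    proof (rule sum_mono)
      fix n
      have "(diameter (U n) / 2)\<^sup>2 \<le> h\<^sup>2"
        using dU[of n] diameter_ge_0[OF bU[of n]] by (intro power_mono) auto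
      then show "hausdorff_gauge 2 (U n) \<le> ennreal (unit_ball_vol 2 * h\<^sup>2)"
        by (auto simp: hausdorff_gauge_def intro!: ennreal_leI mult_left_mono)
    qed
    also have "\<dots> = ennreal (unit_ball_vol 2 * (N * h)\<^sup>2)"
      by (simp add: power2_eq_square mult_ac ennreal_of_nat_eq_real_of_nat flip: ennreal_mult')
    finally show "hausdorff_premeasure 2 \<delta> A \<le> ennreal (unit_ball_vol 2 * R\<^sup>2)"
      using h by simp
  qed
  then show ?thesis by (rule le_less_trans) simp
qed

subsection \<open>The lost strip and the planar flow\<close>

abbreviation closed_sector :: "real \<Rightarrow> (real \<times> real) set" where
  "closed_sector lam \<equiv> {(x, y). lam * \<bar>x\<bar> \<le> y}"

lemma closure_cone_section:
  assumes "0 < lam"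
  shows "closure (cone_section lam) = closed_sector lam"
proof
  have "closed {p :: real \<times> real. lam * \<bar>fst p\<bar> \<le> snd p}"
    by (intro closed_Collect_le continuous_intros)
  then show "closure (cone_section lam) \<subseteq> closed_sector lam"
    unfolding case_prod_unfold by (intro closure_minimal) (auto simp: cone_section_def circular_cone_def cone_profile_def case_prod_beta)
  show "closed_sector lam \<subseteq> closure (cone_section lam)"
  proof clarify
    fix x y :: real assume y: "lam * \<bar>x\<bar> \<le> y"
    \<comment> \<open>Boundary points are approached by vertical shifts into the open
      sector.\<close>
    have "(x, y + inverse (real (Suc n))) \<in> cone_section lam" for n
      using y by (simp add: cone_section_def circular_cone_def cone_profile_def add_strict_increasing2
          order_le_less_trans[OF y])
    moreover have "(\<lambda>n. (x, y + inverse (real (Suc n)))) \<longlonglongrightarrow> (x, y + 0)"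
      by (intro tendsto_intros LIMSEQ_inverse_real_of_nat)
    ultimately show "(x, y) \<in> closure (cone_section lam)"
      unfolding closure_sequential by (intro exI[of _ "\<lambda>n. (x, y + inverse (real (Suc n)))"]) auto
  qed
qed

text \<open>The strip between heights \<open>c / x\<close> and \<open>2 c / x\<close> above the line \<open>y = lam * x\<close>: the lower gap keeps it
  inside the open sector. The inequalities are multiplied by \<open>x > 0\<close> to make closedness evident.\<close>

definition hyperbolic_strip :: "real \<Rightarrow> real \<Rightarrow> real \<Rightarrow> real \<Rightarrow> (real \<times> real) set" where
  "hyperbolic_strip lam c b r =
     {(x, y). b \<le> x \<and> x \<le> r \<and> lam * x\<^sup>2 + c \<le> x * y \<and> x * y \<le> lam * x\<^sup>2 + 2 * c}"

lemma closed_hyperbolic_strip: "closed (hyperbolic_strip lam c b r)"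
  unfolding hyperbolic_strip_def case_prod_beta
  by (intro closed_Collect_conj closed_Collect_le continuous_intros)

text \<open>Since \<open>x\<close> stays above \<open>b > 0\<close>, the bound on
  \<open>x * y\<close> also bounds \<open>y\<close>.\<close>

lemma compact_hyperbolic_strip:
  assumes "0 < b"
  shows "compact (hyperbolic_strip lam c b r)"
proof -
  define m where "m = \<bar>lam\<bar> * r\<^sup>2 + \<bar>c\<bar>"
  have "hyperbolic_strip lam c b r \<subseteq> {b..r} \<times> {- ((m + m) / b) .. (m + m) / b}"
  proof
    fix p assume "p \<in> hyperbolic_strip lam c b r"
    then obtain x y where p: "p = (x, y)" and x: "b \<le> x" "x \<le> r"
      and y: "lam * x\<^sup>2 + c \<le> x * y" "x * y \<le> lam * x\<^sup>2 + 2 * c"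
      by (auto simp: hyperbolic_strip_def)
    have "x\<^sup>2 \<le> r\<^sup>2" using x assms by (intro power_mono) auto
    then have "\<bar>lam * x\<^sup>2\<bar> \<le> \<bar>lam\<bar> * r\<^sup>2" by (simp add: abs_mult mult_left_mono)
    then have "\<bar>x * y\<bar> \<le> m + m" using y by (simp add: m_def abs_le_iff)
    moreover have "b * \<bar>y\<bar> \<le> \<bar>x * y\<bar>" using x assms by (simp add: abs_mult mult_right_mono)
    ultimately have "\<bar>y\<bar> \<le> (m + m) / b" using assms by (simp add: field_simps)
    then show "p \<in> {b..r} \<times> {- ((m + m) / b) .. (m + m) / b}" using x p by auto
  qed
  then have "bounded (hyperbolic_strip lam c b r)"
    by (rule bounded_subset[rotated]) (intro bounded_Times bounded_closed_interval)
  then show ?thesis by (simp add: compact_eq_bounded_closed closed_hyperbolic_strip)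
qed

text \<open>The vertical slice at \<open>x\<close> has length \<open>c / x\<close>, and integrating
  it over \<open>{b..r}\<close> produces the decisive logarithm.\<close>

lemma emeasure_hyperbolic_strip:
  assumes "0 < b" "b \<le> r" "0 \<le> c"
  shows "emeasure lborel (hyperbolic_strip lam c b r) = ennreal (c * ln (r / b))"
proof -
  let ?K = "hyperbolic_strip lam c b r"
  have slice: "emeasure lborel (Pair x -` ?K) = ennreal (c / x) * indicator {b..r} x" for x
  proof (cases "x \<in> {b..r}")
    case True
    then have x: "0 < x" using assms by auto
    have "Pair x -` ?K = {lam * x + c / x .. lam * x + 2 * c / x}"
      using True x by (auto simp: hyperbolic_strip_def field_simps power2_eq_square)
    then show ?thesis using True x assms by (simp add: field_simps)
  next
    case False
    then have "Pair x -` ?K = {}" by (auto simp: hyperbolic_strip_def)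
    then show ?thesis using False by simp
  qed
  have "emeasure lborel ?K = emeasure (lborel \<Otimes>\<^sub>M lborel) ?K"
    by (simp add: lborel_prod)
  also have "\<dots> = (\<integral>\<^sup>+x. emeasure lborel (Pair x -` ?K) \<partial>lborel)"
    by (rule lborel.emeasure_pair_measure_alt) (unfold lborel_prod, simp add: closed_hyperbolic_strip)
  also have "\<dots> = (\<integral>\<^sup>+x. ennreal (c / x) * indicator {b..r} x \<partial>lborel)"
    by (simp add: slice)
  also have "\<dots> = ennreal (c * ln r - c * ln b)"
  proof (rule nn_integral_FTC_Icc)
    fix x assume "x \<in> {b..r}"
    then have "0 < x" using assms by simp
    then show "((\<lambda>x. c * ln x) has_real_derivative c / x) (at x)"
      by (auto intro!: derivative_eq_intros)
    show "0 \<le> c / x" using \<open>0 < x\<close> assms by simp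
  qed (use assms in auto)
  also have "c * ln r - c * ln b = c * ln (r / b)"
    using assms by (simp add: ln_div algebra_simps)
  finally show ?thesis .
qed

section \<open>Lipschitz estimates for the planar flow\<close>

text \<open>The reverse triangle inequality for the Euclidean norm of the plane.\<close>

lemma sqrt_sum_squares_Lipschitz:
  fixes x g x' g' :: real
  shows "\<bar>sqrt (x\<^sup>2 + g\<^sup>2) - sqrt (x'\<^sup>2 + g'\<^sup>2)\<bar> \<le> \<bar>x - x'\<bar> + \<bar>g - g'\<bar>"
proof -
  have "\<bar>norm (x, g) - norm (x', g')\<bar> \<le> norm ((x, g) - (x', g'))"
    by (rule norm_triangle_ineq3)
  also have "\<dots> \<le> \<bar>x - x'\<bar> + \<bar>g - g'\<bar>"
    using sqrt_sum_squares_le_sum_abs by (simp add: norm_prod_def)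
  finally show ?thesis by (simp add: norm_prod_def)
qed

definition planar_flow :: "real \<Rightarrow> (real \<times> real \<Rightarrow> real) \<Rightarrow> real \<Rightarrow> real \<times> real \<Rightarrow> real \<times> real" where
  "planar_flow lam f t p =
     (fst p, snd p + lam * (sqrt ((fst p)\<^sup>2 + (t * f p)\<^sup>2) - \<bar>fst p\<bar>))"

lemma cone_flow_eq:
  fixes f :: "real \<times> real \<Rightarrow> real"
  shows "cone_flow lam f p t = (fst (planar_flow lam f t p), snd (planar_flow lam f t p), t * f p)"
  by (simp add: cone_flow_def planar_flow_def power_mult_distrib algebra_simps)

lemma planar_flow_ge: "0 < lam \<Longrightarrow> snd p \<le> snd (planar_flow lam f t p)"
proof -
  assume "0 < lam"
  have "\<bar>fst p\<bar> = sqrt ((fst p)\<^sup>2)" by simp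
  also have "\<dots> \<le> sqrt ((fst p)\<^sup>2 + (t * f p)\<^sup>2)" by (rule real_sqrt_le_mono) simp
  finally show ?thesis using \<open>0 < lam\<close> by (simp add: planar_flow_def)
qed

lemma fst_planar_flow: "fst (planar_flow lam f t p) = fst p"
  by (simp add: planar_flow_def)

lemma planar_flow_eq_self: "f p = 0 \<Longrightarrow> planar_flow lam f t p = p"
  by (simp add: planar_flow_def prod_eq_iff)

context
  fixes lam L t :: real and f :: "real \<times> real \<Rightarrow> real" and S :: "(real \<times> real) set"
  assumes lam: "0 < lam" and lip: "L-lipschitz_on S f" and t: "0 < t" "lam * L * t \<le> 1/2"
begin

text \<open>Smallness of \<open>t\<close> makes the part of the displacement due to \<open>f\<close>
  Lipschitz with constant 1/2, so it can be absorbed by the identity.\<close>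

lemma scaled_Lipschitz:
  assumes "p \<in> S" "q \<in> S"
  shows "lam * \<bar>t * f p - t * f q\<bar> \<le> dist p q / 2"
proof -
  have "lam * \<bar>t * f p - t * f q\<bar> = lam * t * dist (f p) (f q)"
    using t by (simp add: dist_real_def abs_mult flip: right_diff_distrib)
  also have "\<dots> \<le> lam * t * (L * dist p q)"
    using lipschitz_onD[OF lip] assms lam t by (intro mult_left_mono) auto
  also have "\<dots> = lam * L * t * dist p q" by simp
  also have "\<dots> \<le> 1/2 * dist p q"
    using t by (intro mult_right_mono) auto
  finally show ?thesis by simp
qed

text \<open>On a vertical line the terms in \<open>\<bar>x\<bar>\<close> cancel, and the
  displacement varies by at most half the height difference.\<close>

lemma planar_flow_mono:
  assumes "(x, y) \<in> S" "(x, y') \<in> S" "y \<le> y'"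
  shows "(y' - y) / 2 \<le> snd (planar_flow lam f t (x, y')) - snd (planar_flow lam f t (x, y))"
proof -
  have "lam * \<bar>sqrt (x\<^sup>2 + (t * f (x, y'))\<^sup>2) - sqrt (x\<^sup>2 + (t * f (x, y))\<^sup>2)\<bar>
      \<le> lam * \<bar>t * f (x, y') - t * f (x, y)\<bar>"
    using sqrt_sum_squares_Lipschitz[of x "t * f (x, y')" x "t * f (x, y)"] lam by simp
  also have "\<dots> \<le> (y' - y) / 2"
    using scaled_Lipschitz[of "(x, y')" "(x, y)"] assms by (simp add: dist_prod_def dist_real_def)
  finally have "lam * \<bar>sqrt (x\<^sup>2 + (t * f (x, y'))\<^sup>2) - sqrt (x\<^sup>2 + (t * f (x, y))\<^sup>2)\<bar> \<le> (y' - y) / 2" .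
  then have "\<bar>lam * (sqrt (x\<^sup>2 + (t * f (x, y'))\<^sup>2) - sqrt (x\<^sup>2 + (t * f (x, y))\<^sup>2))\<bar> \<le> (y' - y) / 2"
    using lam by (simp add: abs_mult)
  from abs_le_D2[OF this] show ?thesis unfolding planar_flow_def right_diff_distrib by simp
qed

text \<open>The planar flow is injective with Lipschitz inverse. The horizontal coordinate is kept,
  so horizontal differences are at most \<open>D\<close>; the rest of the displacement is
  absorbed.\<close>

lemma planar_flow_expanding:
  assumes "p \<in> S" "q \<in> S"
  shows "dist p q \<le> (4 + 4 * lam) * dist (planar_flow lam f t p) (planar_flow lam f t q)"
proof -
  obtain x y x' y' where pq: "p = (x, y)" "q = (x', y')" by fastforce
  define D where "D = dist (planar_flow lam f t p) (planar_flow lam f t q)"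
  define a where "a = lam * (sqrt (x\<^sup>2 + (t * f p)\<^sup>2) - sqrt (x'\<^sup>2 + (t * f q)\<^sup>2))"
  define e where "e = lam * (\<bar>x\<bar> - \<bar>x'\<bar>)"
  have x: "\<bar>x - x'\<bar> \<le> D" and Y: "\<bar>(y - y') + a - e\<bar> \<le> D"
    using dist_fst_le[of "planar_flow lam f t p" "planar_flow lam f t q"]
      dist_snd_le[of "planar_flow lam f t p" "planar_flow lam f t q"]
    by (auto simp: D_def planar_flow_def pq a_def e_def dist_real_def algebra_simps)
  have d: "dist p q \<le> \<bar>x - x'\<bar> + \<bar>y - y'\<bar>"
    using sqrt_sum_squares_le_sum_abs by (simp add: pq dist_prod_def dist_real_def)
  have lx: "lam * \<bar>x - x'\<bar> \<le> lam * D" using x lam by simp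
  have "\<bar>a\<bar> \<le> lam * (\<bar>x - x'\<bar> + \<bar>t * f p - t * f q\<bar>)"
    using sqrt_sum_squares_Lipschitz[of x "t * f p" x' "t * f q"] lam by (simp add: a_def abs_mult)
  then have a: "\<bar>a\<bar> \<le> lam * D + dist p q / 2"
    using scaled_Lipschitz[OF assms] lx by (simp add: algebra_simps)
  have "\<bar>\<bar>x\<bar> - \<bar>x'\<bar>\<bar> \<le> \<bar>x - x'\<bar>" by simp
  then have "\<bar>e\<bar> \<le> lam * \<bar>x - x'\<bar>" using lam by (simp add: e_def abs_mult)
  with lx have e: "\<bar>e\<bar> \<le> lam * D" by simp
  \<comment> \<open>Together the bounds give
    \<open>dist p q \<le> 2 * D + 2 * (lam * D) + dist p q / 2\<close>; the last term moves to the
    left.\<close>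
  have "dist p q \<le> 4 * D + 4 * (lam * D)" using x Y a e d by linarith
  then show ?thesis by (simp add: D_def algebra_simps)
qed

text \<open>The flow adds only the height \<open>t * f p\<close> to the planar flow. By expansion
  this height is an \<open>O(t)\<close>-Lipschitz function of the planar image, and Pythagoras gives
  a factor whose square is \<open>1 + O(t\<^sup>2)\<close>.\<close>

lemma cone_flow_Lipschitz:
  assumes "p \<in> S" "q \<in> S"
  shows "dist (cone_flow lam f p t) (cone_flow lam f q t)
    \<le> sqrt (1 + (L * (4 + 4 * lam))\<^sup>2 * t\<^sup>2) * dist (planar_flow lam f t p) (planar_flow lam f t q)"
proof -
  have L: "0 \<le> L" using lip by (rule lipschitz_on_nonneg)
  define D where "D = dist (planar_flow lam f t p) (planar_flow lam f t q)"
  have "dist (t * f p) (t * f q) = t * dist (f p) (f q)"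
    using t by (simp add: dist_real_def abs_mult flip: right_diff_distrib)
  also have "\<dots> \<le> t * (L * dist p q)"
    using lipschitz_onD[OF lip] assms t by (intro mult_left_mono) auto
  also have "\<dots> \<le> t * (L * ((4 + 4 * lam) * D))"
    unfolding D_def using planar_flow_expanding assms t L by (intro mult_left_mono) auto
  finally have "(dist (t * f p) (t * f q))\<^sup>2 \<le> (t * (L * ((4 + 4 * lam) * D)))\<^sup>2"
    by (rule power_mono) simp
  also have "\<dots> = (L * (4 + 4 * lam))\<^sup>2 * t\<^sup>2 * D\<^sup>2" by (simp add: power_mult_distrib)
  finally have h: "(dist (t * f p) (t * f q))\<^sup>2 \<le> (L * (4 + 4 * lam))\<^sup>2 * t\<^sup>2 * D\<^sup>2" .
  have "dist (cone_flow lam f p t) (cone_flow lam f q t) = sqrt (D\<^sup>2 + (dist (t * f p) (t * f q))\<^sup>2)"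
    by (simp add: cone_flow_eq D_def dist_prod_def add.assoc)
  also have "\<dots> \<le> sqrt ((1 + (L * (4 + 4 * lam))\<^sup>2 * t\<^sup>2) * D\<^sup>2)"
    using h by (intro real_sqrt_le_mono) (simp add: algebra_simps)
  also have "\<dots> = sqrt (1 + (L * (4 + 4 * lam))\<^sup>2 * t\<^sup>2) * D"
    by (simp add: real_sqrt_mult D_def)
  finally show ?thesis by (simp add: D_def)
qed

end

subsection \<open>Area of the flowed surface\<close>

definition moving_domain :: "real \<Rightarrow> (real \<times> real \<Rightarrow> real) \<Rightarrow> (real \<times> real) set" where
  "moving_domain lam f = cone_section lam \<inter> spt_on (closure (cone_section lam)) f"

lemma moving_domain_iff:
  assumes "0 < lam"
  shows "(x, y) \<in> moving_domain lam f
    \<longleftrightarrow> lam * \<bar>x\<bar> < y \<and> (x, y) \<in> spt_on (closed_sector lam) f"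
  unfolding moving_domain_def closure_cone_section[OF assms]
  by (simp add: cone_section_def circular_cone_def cone_profile_def)

lemma in_spt_on: "p \<in> S \<Longrightarrow> f p \<noteq> 0 \<Longrightarrow> p \<in> spt_on S f"
  unfolding spt_on_def by (rule subsetD[OF closure_subset]) simp

context
  fixes lam L t a r :: real and f :: "real \<times> real \<Rightarrow> real"
  assumes lam: "0 < lam" and lip: "L-lipschitz_on (closed_sector lam) f"
    and t: "0 < t" "lam * L * t \<le> 1/2"
    and a: "0 < a" "t * a \<le> r"
    and fa: "\<And>p. p \<in> closed_sector lam \<Longrightarrow> norm p \<le> (1 + 2 * lam) * r \<Longrightarrow> a \<le> \<bar>f p\<bar>"
begin

text \<open>The flow moves every point of a vertical ray upwards by an increasing map fixing the zeros
  of \<open>f\<close>; hence it cannot carry a nonzero of \<open>f\<close> to a zero.\<close>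

lemma planar_flow_in_moving_domain:
  assumes "p \<in> moving_domain lam f"
  shows "planar_flow lam f t p \<in> moving_domain lam f"
proof (cases "f p = 0")
  case True
  then show ?thesis using assms by (simp add: planar_flow_eq_self)
next
  case False
  obtain x y where p: "p = (x, y)" by fastforce
  define z where "z = snd (planar_flow lam f t p)"
  have Pp: "planar_flow lam f t p = (x, z)" by (simp add: z_def p planar_flow_def)
  have y: "lam * \<bar>x\<bar> < y" using assms lam by (simp add: p moving_domain_iff)
  have z: "y \<le> z" using planar_flow_ge[OF lam, of p f t] by (simp add: p z_def)
  have "f (x, z) \<noteq> 0"
  proof
    assume 0: "f (x, z) = 0"
    have "(z - y) / 2 \<le> snd (planar_flow lam f t (x, z)) - snd (planar_flow lam f t (x, y))"
      using y z by (intro planar_flow_mono[OF lam lip t]) auto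
    also have "\<dots> = 0"
      using planar_flow_eq_self[of f "(x, z)" lam t, OF 0] Pp unfolding p by simp
    finally have "z = y" using z by simp
    with 0 False p show False by blast
  qed
  moreover have "lam * \<bar>x\<bar> < z" using y z by linarith
  ultimately show ?thesis unfolding Pp moving_domain_iff[OF lam] by (simp add: in_spt_on)
qed

text \<open>Each point is compared with the boundary point below it on the same vertical line;
  monotonicity keeps its image above the image of that boundary point.\<close>

lemma planar_flow_above:
  assumes "p \<in> moving_domain lam f"
  shows "lam * sqrt ((fst p)\<^sup>2 + (t * f (fst p, lam * \<bar>fst p\<bar>))\<^sup>2) \<le> snd (planar_flow lam f t p)"
proof -
  obtain x y where p: "p = (x, y)" by fastforce
  have y: "lam * \<bar>x\<bar> < y" using assms lam by (simp add: p moving_domain_iff)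
  then have "(y - lam * \<bar>x\<bar>) / 2
      \<le> snd (planar_flow lam f t (x, y)) - snd (planar_flow lam f t (x, lam * \<bar>x\<bar>))"
    by (intro planar_flow_mono[OF lam lip t]) auto
  then have "snd (planar_flow lam f t (x, lam * \<bar>x\<bar>)) \<le> snd (planar_flow lam f t (x, y))"
    using y by simp
  then show ?thesis by (simp add: p planar_flow_def algebra_simps)
qed

text \<open>With \<open>b = t * a\<close>, the strip rises at most
  \<open>lam * b\<^sup>2 / (6 * x)\<close> above the line. For \<open>x \<ge> b\<close> this stays
  under the moved boundary, because \<open>(x + b\<^sup>2 / (6 * x))\<^sup>2 \<le> x\<^sup>2 +
  b\<^sup>2 * (1/3 + 1/36)\<close>. The radius \<open>(1 + 2 * lam) * r\<close> comes from
  \<open>x \<le> r\<close> and \<open>y \<le> 2 * lam * r\<close>.\<close>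

lemma hyperbolic_strip_bounds:
  assumes "(x, y) \<in> hyperbolic_strip lam (lam * (t * a)\<^sup>2 / 12) (t * a) r"
  shows "0 < x" "lam * x < y" "norm (x, y) \<le> (1 + 2 * lam) * r"
    "y < lam * sqrt (x\<^sup>2 + (t * f (x, lam * \<bar>x\<bar>))\<^sup>2)"
proof -
  define b where "b = t * a"
  have b: "0 < b" using t a by (simp add: b_def)
  have x: "b \<le> x" "x \<le> r" "lam * x\<^sup>2 + lam * b\<^sup>2 / 12 \<le> x * y" "x * y \<le> lam * x\<^sup>2 + 2 * (lam * b\<^sup>2 / 12)"
    using assms by (auto simp: hyperbolic_strip_def b_def)
  show x0: "0 < x" using x b by simp
  have b2: "0 < lam * b\<^sup>2" using lam b by simp
  have "x * (lam * x) < x * y" using x b2 by (simp add: power2_eq_square algebra_simps)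
  then show y: "lam * x < y" using x0 by simp
  have bx: "b\<^sup>2 \<le> x\<^sup>2" using x b by (intro power_mono) auto
  have up: "y \<le> lam * (x + b\<^sup>2 / (6 * x))"
    using x(4) x0 by (simp add: field_simps power2_eq_square)
  have b6: "b\<^sup>2 / (6 * x) \<le> x / 6" using bx x0 by (simp add: field_simps power2_eq_square)
  have "y \<le> lam * (2 * r)"
  proof -
    have "x + b\<^sup>2 / (6 * x) \<le> 2 * r" using b6 x(2) x0 by linarith
    then have "lam * (x + b\<^sup>2 / (6 * x)) \<le> lam * (2 * r)" using lam by simp
    with up show ?thesis by (rule order_trans)
  qed
  moreover have "0 < y" using less_trans[OF mult_pos_pos[OF lam x0] y] .
  ultimately have sum: "\<bar>x\<bar> + \<bar>y\<bar> \<le> (1 + 2 * lam) * r" using x x0 by (simp add: algebra_simps)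
  have nb: "norm (u, v) \<le> \<bar>u\<bar> + \<bar>v\<bar>" for u v :: real
    using sqrt_sum_squares_le_sum_abs by (simp add: norm_prod_def)
  show "norm (x, y) \<le> (1 + 2 * lam) * r" using nb sum by (rule order_trans)
  \<comment> \<open>The boundary point below \<open>(x, y)\<close> lies in the same ball, so
    \<open>\<bar>f\<bar> \<ge> a\<close> there too.\<close>
  have "\<bar>x\<bar> + \<bar>lam * x\<bar> \<le> \<bar>x\<bar> + \<bar>y\<bar>" using y x0 lam by (simp add: abs_mult)
  also note sum
  finally have "norm (x, lam * x) \<le> (1 + 2 * lam) * r" by (rule order_trans[OF nb])
  then have "a \<le> \<bar>f (x, lam * x)\<bar>" using x0 by (intro fa) auto
  then have "b \<le> \<bar>t * f (x, lam * x)\<bar>" using t by (simp add: b_def abs_mult)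
  then have "b\<^sup>2 \<le> (t * f (x, lam * x))\<^sup>2" using b by (simp flip: abs_le_square_iff)
  moreover have "(x + b\<^sup>2 / (6 * x))\<^sup>2 < x\<^sup>2 + b\<^sup>2"
  proof -
    have "(x + b\<^sup>2 / (6 * x))\<^sup>2 = x\<^sup>2 + b\<^sup>2 / 3 + (b\<^sup>2 / (6 * x))\<^sup>2"
      using x0 by (simp add: power2_sum)
    moreover have "(b\<^sup>2 / (6 * x))\<^sup>2 = b\<^sup>2 / (6 * x) * (b\<^sup>2 / (6 * x))" by (rule power2_eq_square)
    moreover have "\<dots> \<le> x / 6 * (b\<^sup>2 / (6 * x))"
      using b6 x0 by (intro mult_right_mono) auto
    moreover have "\<dots> = b\<^sup>2 / 36" using x0 by simp
    moreover have "0 < b\<^sup>2" using b by simp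
    ultimately show ?thesis by linarith
  qed
  ultimately have "(x + b\<^sup>2 / (6 * x))\<^sup>2 < x\<^sup>2 + (t * f (x, lam * x))\<^sup>2" by linarith
  then have "x + b\<^sup>2 / (6 * x) < sqrt (x\<^sup>2 + (t * f (x, lam * x))\<^sup>2)" by (rule real_less_rsqrt)
  then have "lam * (x + b\<^sup>2 / (6 * x)) < lam * sqrt (x\<^sup>2 + (t * f (x, lam * x))\<^sup>2)"
    using lam by simp
  with up x0 show "y < lam * sqrt (x\<^sup>2 + (t * f (x, lam * \<bar>x\<bar>))\<^sup>2)" by simp
qed

lemma hyperbolic_strip_subset_moving_domain:
  "hyperbolic_strip lam (lam * (t * a)\<^sup>2 / 12) (t * a) r \<subseteq> moving_domain lam f"
proof clarify
  fix x y assume "(x, y) \<in> hyperbolic_strip lam (lam * (t * a)\<^sup>2 / 12) (t * a) r"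
  note * = hyperbolic_strip_bounds[OF this]
  have S: "(x, y) \<in> closed_sector lam" using * by simp
  then have "f (x, y) \<noteq> 0" using fa[OF S *(3)] a by auto
  then show "(x, y) \<in> moving_domain lam f"
    using * lam S by (simp add: moving_domain_iff in_spt_on)
qed

text \<open>The image lies in the closed region \<open>C\<close> above the moved boundary, and the
  compact strip misses \<open>C\<close>. They are therefore a positive distance apart, so their
  measures add up inside the original domain.\<close>

lemma hausdorff_measure_planar_flow_add_strip:
  "hausdorff_measure k (planar_flow lam f t ` moving_domain lam f)
     + hausdorff_measure k (hyperbolic_strip lam (lam * (t * a)\<^sup>2 / 12) (t * a) r)
   \<le> hausdorff_measure k (moving_domain lam f)"
proof -
  let ?K = "hyperbolic_strip lam (lam * (t * a)\<^sup>2 / 12) (t * a) r"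
  define C where "C = {p. lam * sqrt ((fst p)\<^sup>2 + (t * f (fst p, lam * \<bar>fst p\<bar>))\<^sup>2) \<le> snd p}"
  \<comment> \<open>The point \<open>(x, lam * \<bar>x\<bar>)\<close> always lies in the closed
    sector, where \<open>f\<close> is Lipschitz; this makes \<open>C\<close> closed.\<close>
  have "continuous_on UNIV (\<lambda>p :: real \<times> real. f (fst p, lam * \<bar>fst p\<bar>))"
    by (rule continuous_on_compose2[OF lipschitz_on_continuous_on[OF lip]])
      (auto intro!: continuous_intros)
  then have "closed C"
    unfolding C_def by (intro closed_Collect_le continuous_intros)
  moreover have "?K \<inter> C = {}"
    using hyperbolic_strip_bounds(4) by (fastforce simp: C_def)
  moreover have "compact ?K" using t a by (intro compact_hyperbolic_strip) simp
  ultimately obtain d where d: "0 < d" "\<forall>x\<in>?K. \<forall>y\<in>C. d \<le> dist x y"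
    using separate_compact_closed by blast
  have PC: "planar_flow lam f t ` moving_domain lam f \<subseteq> C"
    by (rule image_subsetI) (simp add: C_def fst_planar_flow planar_flow_above)
  have "hausdorff_measure k (planar_flow lam f t ` moving_domain lam f) + hausdorff_measure k ?K
      \<le> hausdorff_measure k (planar_flow lam f t ` moving_domain lam f \<union> ?K)"
  proof (rule hausdorff_measure_add_le[OF d(1)])
    fix p q assume "p \<in> planar_flow lam f t ` moving_domain lam f" "q \<in> ?K"
    then have "d \<le> dist q p" using d(2) PC by blast
    then show "d \<le> dist p q" by (simp add: dist_commute)
  qed
  also have "\<dots> \<le> hausdorff_measure k (moving_domain lam f)"
    using planar_flow_in_moving_domain hyperbolic_strip_subset_moving_domain
    by (intro hausdorff_measure_mono) auto
  finally show ?thesis .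
qed

text \<open>The constant 48 is the 12 of the strip times the factor 4 lost against Lebesgue measure.
  The second claim makes the bound nonnegative, so that it can be read in the reals.\<close>

lemma hausdorff_measure_cone_flow_le:
  assumes "bounded (moving_domain lam f)"
  defines "h \<equiv> enn2real (hausdorff_measure 2 (moving_domain lam f))"
  shows "hausdorff_measure 2 ((\<lambda>p. cone_flow lam f p t) ` moving_domain lam f)
    \<le> ennreal ((1 + (L * (4 + 4 * lam))\<^sup>2 * t\<^sup>2) * (h - lam * (t * a)\<^sup>2 / 48 * ln (r / (t * a))))"
    and "lam * (t * a)\<^sup>2 / 48 * ln (r / (t * a)) \<le> h"
proof -
  let ?E = "moving_domain lam f"
  let ?P = "planar_flow lam f t ` moving_domain lam f"
  let ?K = "hyperbolic_strip lam (lam * (t * a)\<^sup>2 / 12) (t * a) r"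
  define M where "M = (L * (4 + 4 * lam))\<^sup>2"
  define q where "q = lam * (t * a)\<^sup>2 / 12 * ln (r / (t * a))"
  have b: "0 < t * a" using t a by simp
  have M: "0 \<le> M" by (simp add: M_def)
  have hE: "hausdorff_measure 2 ?E = ennreal h"
    unfolding h_def using hausdorff_measure_2_bounded[OF assms(1)] by simp
  have sum: "hausdorff_measure 2 ?P + hausdorff_measure 2 ?K \<le> ennreal h"
    using hausdorff_measure_planar_flow_add_strip[of 2] hE by simp
  obtain u v where uv: "hausdorff_measure 2 ?P = ennreal u" "0 \<le> u"
      "hausdorff_measure 2 ?K = ennreal v" "0 \<le> v"
    using sum
    by (cases "hausdorff_measure 2 ?P"; cases "hausdorff_measure 2 ?K") (auto simp: top_unique)
  have h0: "0 \<le> h" by (simp add: h_def)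
  have uvh: "u + v \<le> h"
    using sum h0 uv by (simp flip: ennreal_plus)
  have "ennreal q = emeasure lborel ?K"
    unfolding q_def using b a lam by (intro emeasure_hyperbolic_strip[symmetric]) auto
  also have "\<dots> \<le> ennreal 4 * ennreal v"
    using emeasure_lborel_le_hausdorff_measure[of ?K] uv by (simp flip: numeral_2_eq_2)
  also have "\<dots> = ennreal (4 * v)" using uv by (simp add: ennreal_mult')
  finally have "q \<le> 4 * v" using uv by (simp add: ennreal_le_iff)
  with uvh have u: "u \<le> h - q / 4" by simp
  then show "lam * (t * a)\<^sup>2 / 48 * ln (r / (t * a)) \<le> h" using uv by (simp add: q_def)
  have "hausdorff_measure 2 ((\<lambda>p. cone_flow lam f p t) ` ?E)
      \<le> ennreal (sqrt (1 + M * t\<^sup>2) ^ 2) * hausdorff_measure 2 ?P"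
  proof (rule hausdorff_measure_image_le)
    show "0 < sqrt (1 + M * t\<^sup>2)" using M by (simp add: add_pos_nonneg)
    fix p q assume "p \<in> ?E" "q \<in> ?E"
    then have "p \<in> closed_sector lam" "q \<in> closed_sector lam"
      using lam by (cases p, cases q, simp add: moving_domain_iff)+
    then show "dist (cone_flow lam f p t) (cone_flow lam f q t)
        \<le> sqrt (1 + M * t\<^sup>2) * dist (planar_flow lam f t p) (planar_flow lam f t q)"
      unfolding M_def using cone_flow_Lipschitz[OF lam lip t] by blast
  qed
  also have "\<dots> = ennreal ((1 + M * t\<^sup>2) * u)"
    using M uv by (simp add: ennreal_mult)
  also have "\<dots> \<le> ennreal ((1 + M * t\<^sup>2) * (h - q / 4))"
    using M u by (intro ennreal_leI mult_left_mono) auto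
  finally show "hausdorff_measure 2 ((\<lambda>p. cone_flow lam f p t) ` ?E)
    \<le> ennreal ((1 + (L * (4 + 4 * lam))\<^sup>2 * t\<^sup>2) * (h - lam * (t * a)\<^sup>2 / 48 * ln (r / (t * a))))"
    by (simp add: M_def q_def)
qed

end

section \<open>The area near time zero and its lower derivative\<close>

lemma flow_area_eq:
  fixes f :: "real \<times> real \<Rightarrow> real"
  shows "flow_area lam f t
    = enn2ereal (hausdorff_measure 2 ((\<lambda>p. cone_flow lam f p t) ` moving_domain lam f))"
  by (simp add: flow_area_def moving_domain_def numeral_2_eq_2)

text \<open>At time 0 the flow is an isometric embedding, so the comparison of images applies in
  both directions.\<close>

lemma flow_area_0:
  fixes f :: "real \<times> real \<Rightarrow> real"
  shows "flow_area lam f 0 = enn2ereal (hausdorff_measure 2 (moving_domain lam f))"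
proof -
  let ?E = "moving_domain lam f" and ?F = "\<lambda>p. cone_flow lam f p 0"
  have d: "dist (?F p) (?F q) = dist p q" for p q
    by (simp add: cone_flow_def dist_prod_def)
  have "hausdorff_measure 2 (?F ` ?E) \<le> ennreal (1 ^ 2) * hausdorff_measure 2 (id ` ?E)"
    by (rule hausdorff_measure_image_le) (auto simp: d)
  moreover have "hausdorff_measure 2 (id ` ?E) \<le> ennreal (1 ^ 2) * hausdorff_measure 2 (?F ` ?E)"
    by (rule hausdorff_measure_image_le) (auto simp: d)
  ultimately show ?thesis
    by (simp add: flow_area_eq)
qed

text \<open>For small \<open>s\<close> the logarithmic loss is at least
  \<open>s * (M * h + 1)\<close>, while the stretching gains at most \<open>s * M * h\<close>; every
  difference quotient is then at most -1.\<close>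

lemma lower_right_derivative_flow_area_neg:
  fixes f :: "real \<times> real \<Rightarrow> real"
  assumes lam: "0 < lam"
    and f: "f \<in> lipschitz_compact_support (closure (cone_section lam))" and f0: "f 0 \<noteq> 0"
  shows "lower_right_derivative_0 (flow_area_sqrt lam f) < 0"
proof -
  obtain L where lip: "L-lipschitz_on (closed_sector lam) f"
    and cpt: "compact (spt_on (closed_sector lam) f)"
    using f lam by (auto simp: lipschitz_compact_support_def closure_cone_section)
  have L: "0 \<le> L" using lip by (rule lipschitz_on_nonneg)
  define a where "a = \<bar>f 0\<bar> / 2"
  \<comment> \<open>On the ball of radius \<open>(1 + 2 * lam) * r\<close> the function changes by
    at most \<open>a\<close>, half of \<open>\<bar>f 0\<bar>\<close>. Using \<open>L + 1\<close>
    avoids division by zero.\<close>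
  define r where "r = a / ((L + 1) * (1 + 2 * lam))"
  have a: "0 < a" using f0 by (simp add: a_def)
  have r: "0 < r" using a L lam by (simp add: r_def)
  have fa: "a \<le> \<bar>f p\<bar>" if p: "p \<in> closed_sector lam" "norm p \<le> (1 + 2 * lam) * r" for p
  proof -
    have "\<bar>f p - f 0\<bar> \<le> L * norm p"
      using lipschitz_onD[OF lip p(1), of 0] by (simp add: dist_real_def dist_norm case_prod_unfold)
    also have "\<dots> \<le> (L + 1) * ((1 + 2 * lam) * r)"
      using p L by (intro mult_mono) auto
    also have "\<dots> = a" using L lam by (simp add: r_def)
    finally have "\<bar>f p - f 0\<bar> \<le> \<bar>f 0\<bar> / 2" by (simp add: a_def)
    with abs_triangle_ineq2_sym[of "f 0" "f p"] show ?thesis unfolding a_def by linarith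
  qed
  have bdd: "bounded (moving_domain lam f)"
    using lam
    by (intro bounded_subset[OF compact_imp_bounded[OF cpt]])
      (auto simp: moving_domain_def closure_cone_section)
  define h where "h = enn2real (hausdorff_measure 2 (moving_domain lam f))"
  have hE: "hausdorff_measure 2 (moving_domain lam f) = ennreal h"
    unfolding h_def using hausdorff_measure_2_bounded[OF bdd] by simp
  define M where "M = (L * (4 + 4 * lam))\<^sup>2"
  \<comment> \<open>\<open>N\<close> is the size of the logarithm at which the loss
    \<open>lam * (t * a)\<^sup>2 / 48 * N\<close> equals \<open>s * (M * h + 1)\<close>. The first
    bound in \<open>e\<close> gives \<open>lam * L * t \<le> 1/2\<close>, the second
    \<open>N \<le> ln (r / (t * a))\<close>.\<close>
  define N where "N = 48 * (M * h + 1) / (lam * a\<^sup>2)"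
  define e where "e = min (1 / (2 * lam * (L + 1))) (r / a * exp (- N))"
  have h: "0 \<le> h" and M: "0 \<le> M" by (simp_all add: h_def M_def)
  have N: "0 \<le> N" using h M lam by (simp add: N_def)
  have e: "0 < e" using lam L a r by (simp add: e_def)
  have bound: "(flow_area_sqrt lam f s - flow_area_sqrt lam f 0) / ereal s \<le> ereal (-1)"
    if s: "0 < s" "s < e\<^sup>2" for s
  proof -
    define t where "t = sqrt s"
    have t: "0 < t" "t \<le> e" "t\<^sup>2 = s"
      using s e by (auto simp: t_def intro!: real_le_lsqrt)
    have "lam * L * t \<le> lam * (L + 1) * (1 / (2 * lam * (L + 1)))"
      using t lam L by (intro mult_mono) (auto simp: e_def)
    then have t1: "lam * L * t \<le> 1 / 2" using lam L by simp
    have ta: "t * a \<le> r * exp (- N)" using t a by (simp add: e_def field_simps)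
    also have "\<dots> \<le> r" using r N by simp
    finally have t2: "t * a \<le> r" .
    have "exp N \<le> r / (t * a)" using ta t a by (simp add: exp_minus field_simps)
    then have ln: "N \<le> ln (r / (t * a))" using t a r by (simp add: ln_ge_iff)
    define q where "q = lam * (t * a)\<^sup>2 / 48 * ln (r / (t * a))"
    have q0: "0 \<le> q" unfolding q_def using lam ln N by simp
    have "lam * (t * a)\<^sup>2 / 48 * N \<le> q" unfolding q_def using ln lam by (intro mult_left_mono) auto
    moreover have "lam * (t * a)\<^sup>2 / 48 * N = s * (M * h + 1)"
      using lam a t by (simp add: N_def power_mult_distrib)
    ultimately have q: "s * (M * h + 1) \<le> q" by simp
    have le: "hausdorff_measure 2 ((\<lambda>p. cone_flow lam f p t) ` moving_domain lam f)
        \<le> ennreal ((1 + M * s) * (h - q))"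
      and qh: "q \<le> h"
      using hausdorff_measure_cone_flow_le[OF lam lip t(1) t1 a t2 fa bdd]
      by (simp_all only: h_def M_def q_def t(3))
    then obtain u where u: "0 \<le> u"
      "hausdorff_measure 2 ((\<lambda>p. cone_flow lam f p t) ` moving_domain lam f) = ennreal u"
      by (cases "hausdorff_measure 2 ((\<lambda>p. cone_flow lam f p t) ` moving_domain lam f)") (auto simp: top_unique)
    have "u \<le> (1 + M * s) * (h - q)" using le u qh M s by simp
    \<comment> \<open>The dropped term \<open>- M * s * q\<close> is nonpositive.\<close>
    also have "\<dots> \<le> h + M * s * h - q" using M s q0 by (simp add: algebra_simps)
    also have "\<dots> \<le> h - s" using q by (simp add: algebra_simps)
    finally have "u \<le> h - s" .
    then have "(u - h) / s \<le> -1" using s by (simp add: field_simps)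
    moreover have "flow_area_sqrt lam f s = ereal u"
      using u by (simp add: flow_area_sqrt_def flow_area_eq t_def enn2ereal_ennreal)
    moreover have "flow_area_sqrt lam f 0 = ereal h"
      using hE h by (simp add: flow_area_sqrt_def flow_area_0 enn2ereal_ennreal)
    ultimately show ?thesis using s by simp
  qed
  have "\<forall>\<^sub>F s in at_right 0. (flow_area_sqrt lam f s - flow_area_sqrt lam f 0) / ereal s \<le> ereal (-1)"
    unfolding eventually_at_right_field using e bound by (intro exI[of _ "e\<^sup>2"]) auto
  then have "lower_right_derivative_0 (flow_area_sqrt lam f) \<le> Liminf (at_right (0::real)) (\<lambda>_. ereal (-1))"
    unfolding lower_right_derivative_0_def by (rule Liminf_mono)
  also have "\<dots> = ereal (-1)" by (simp add: Liminf_const)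
  finally show ?thesis by (rule order_le_less_trans) simp
qed

section \<open>An admissible function that does not vanish at the apex\<close>

lemma hat_function_in_lipschitz_compact_support:
  fixes S :: "'a::euclidean_space set"
  shows "(\<lambda>p. max 0 (1 - norm p)) \<in> lipschitz_compact_support S"
proof -
  have "1-lipschitz_on S (\<lambda>p. max 0 (1 - norm p))"
  proof (rule lipschitz_onI)
    fix p q :: 'a
    have "\<bar>norm p - norm q\<bar> \<le> dist p q" by (simp add: dist_norm norm_triangle_ineq3)
    then show "dist (max 0 (1 - norm p)) (max 0 (1 - norm q)) \<le> 1 * dist p q"
      by (simp add: dist_real_def max_def abs_le_iff)
  qed simp
  moreover have "bounded (spt_on S (\<lambda>p. max 0 (1 - norm p)))"
    unfolding spt_on_def
    by (intro bounded_closure bounded_subset[OF bounded_cball[of 0 1]]) (auto simp: max_def split: if_splits)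
  ultimately show ?thesis
    by (auto simp: lipschitz_compact_support_def compact_eq_bounded_closed spt_on_def)
qed

theorem theorem3p4:
  fixes lam :: real
  assumes "lam > 0"
  shows "(\<forall>f \<in> lipschitz_compact_support (closure (cone_section lam :: (real \<times> real) set)).
            f 0 \<noteq> 0 \<longrightarrow> lower_right_derivative_0 (flow_area_sqrt lam f) < 0)
         \<and> \<not> stable_cone_section TYPE(real) lam"
proof -
  have neg: "lower_right_derivative_0 (flow_area_sqrt lam f) < 0"
    if "f \<in> lipschitz_compact_support (closure (cone_section lam :: (real \<times> real) set))" "f 0 \<noteq> 0" for f
    using lower_right_derivative_flow_area_neg assms that by blast
  moreover have "\<not> stable_cone_section TYPE(real) lam"
    unfolding stable_cone_section_def
  proof
    let ?f = "\<lambda>p :: real \<times> real. max 0 (1 - norm p)"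
    assume "\<forall>f\<in>lipschitz_compact_support (closure (cone_section lam :: (real \<times> real) set)).
      0 \<le> lower_right_derivative_0 (flow_area_sqrt lam f)"
    then have "0 \<le> lower_right_derivative_0 (flow_area_sqrt lam ?f)"
      using hat_function_in_lipschitz_compact_support by (rule bspec)
    moreover have "lower_right_derivative_0 (flow_area_sqrt lam ?f) < 0"
      by (rule neg[OF hat_function_in_lipschitz_compact_support]) simp
    ultimately show False by (simp add: not_less[symmetric])
  qed
  ultimately show ?thesis by blast
qed

end
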